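(* Let $p$ be any prime, and let $\mathbb{Z}_p$ denote the finite field with $p$ elements. Let $k$ be any positive integer. (1) The abelian group $\left(\mathcal{P}_{\cup_p},\cup_p\right)$ forms a vector space over $\mathbb{Z}_p$. (2) The abelian group $\left(\mathcal{P}_k^+,+_k\right)$ forms a vector space over $\mathbb{Z}_p$.
   Context: A partition is a finite weakly decreasing sequence $\lambda=(\lambda_1,\dots,\lambda_\ell)$ of positive integers; the empty partition $\emptyset$ is allowed; $\ell(\lambda)=\ell$ is its length; by convention $\lambda_j=0$ for $j>\ell(\lambda)$. $\mathcal{P}_{\cup_p}$ is the set of partitions in which every part has multiplicity less than $p$. For partitions $\lambda,\pi$, $\lambda\cup_p\pi$ is obtained by concatenating the parts of $\lambda$ and $\pi$, reordering into weakly decreasing order, and then repeatedly removing any $p$ parts of the same size until every part has multiplicity less than $p$. $(\mathcal{P}_{\cup_p},\cup_p)$ is an abelian group with identity $\emptyset$. $\mathcal{P}_k^+$ is the set of partitions in which the difference between any two consecutive parts is less than $k$ and the smallest part is less than $k$ (it contains $\emptyset$). Component-wise reduction modulo $k$ sends a partition $\lambda=(\lambda_1,\dots,\lambda_\ell)$ to $\lambda'=(\lambda_1',\dots,\lambda_\ell')$ (trailing zeros omitted; $\emptyset\mapsto\emptyset$), where $\lambda_\ell'=\lambda_\ell-\lfloor\lambda_\ell/k\rfloor k$ and, recursively for $j=\ell-1,\dots,1$, $\lambda_j'=\lambda_j-\left\lfloor(\lambda_j-\lambda_{j+1}')/k\right\rfloor k$. For partitions $\lambda,\pi$, $\lambda+_k\pi$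 is the component-wise reduction modulo $k$ of the partition $(\lambda_1+\pi_1,\lambda_2+\pi_2,\dots)$. $(\mathcal{P}_k^+,+_k)$ is an abelian group with identity $\emptyset$. Scalar multiplication by $a\in\mathbb{Z}_p$ (represented by an integer $0\le a<p$) is defined by $a\lambda:=\lambda\cup_p\cdots\cup_p\lambda$ ($a$ times) in part (1), and by $a\lambda:=\lambda+_k\cdots+_k\lambda$ ($a$ times) in part (2), with $0\lambda=\emptyset$.
   Formalization: Part (2) is stated only for k = 1 or k = p, since for every other positive integer k it is false: for p = 2, k = 3, λ = (1), (1+1)λ = 0λ = ∅ but λ +_3 λ = (2). *)

theory Defs
  imports
    "HOL-Library.Multiset"
    "HOL-Library.More_List"
    "HOL-Algebra.Module"
    "HOL-Number_Theory.Residues"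
begin

definition is_partition :: "nat list \<Rightarrow> bool" where
  "is_partition xs \<longleftrightarrow> sorted_wrt (\<ge>) xs \<and> (\<forall>x\<in>set xs. 0 < x)"

(* parts are indexed from 0; entries beyond the length are 0 *)
abbreviation part :: "nat list \<Rightarrow> nat \<Rightarrow> nat" where
  "part xs i \<equiv> nth_default 0 xs i"

definition mult_less_partitions :: "nat \<Rightarrow> nat list set" where
  "mult_less_partitions p = {xs. is_partition xs \<and> (\<forall>x\<in>set xs. count (mset xs) x < p)}"

definition remove_equal_parts :: "nat \<Rightarrow> nat multiset \<Rightarrow> nat multiset \<Rightarrow> bool" where
  "remove_equal_parts p M N \<longleftrightarrow> (\<exists>x. p \<le> count M x \<and> N = M - replicate_mset p x)"

(* A partition is determined by its multiset of parts, so concatenation followed by reordering is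
   the sum of multisets. The final result does not depend on the order in which the blocks of p
   equal parts are removed; see count_cup. *)
definition cup :: "nat \<Rightarrow> nat list \<Rightarrow> nat list \<Rightarrow> nat list" where
  "cup p xs ys = (THE zs. zs \<in> mult_less_partitions p \<and>
     (remove_equal_parts p)\<^sup>*\<^sup>* (mset xs + mset ys) (mset zs))"

definition small_diff_partitions :: "nat \<Rightarrow> nat list set" where
  "small_diff_partitions k = {xs. is_partition xs \<and>
     (\<forall>i. Suc i < length xs \<longrightarrow> xs ! i - xs ! Suc i < k) \<and> (xs \<noteq> [] \<longrightarrow> last xs < k)}"

(* Reduction before the trailing zeros are dropped. On weakly decreasing lists the already reduced
   next entry is at most the next entry, hence at most x, so that the natural-number subtractions
   do not truncate. For the last entry the next reduced entry is read as 0. *)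
fun reduce_raw :: "nat \<Rightarrow> nat list \<Rightarrow> nat list" where
  "reduce_raw k [] = []"
| "reduce_raw k (x # xs) =
     (let ys = reduce_raw k xs in (x - ((x - part ys 0) div k) * k) # ys)"

definition reduce :: "nat \<Rightarrow> nat list \<Rightarrow> nat list" where
  "reduce k xs = strip_while (\<lambda>x. x = 0) (reduce_raw k xs)"

definition plus_mod :: "nat \<Rightarrow> nat list \<Rightarrow> nat list \<Rightarrow> nat list" where
  "plus_mod k xs ys =
     reduce k (map (\<lambda>i. part xs i + part ys i) [0..<max (length xs) (length ys)])"

(* The fields mult and one of a module record play no role in the locale module. *)
definition cup_module :: "nat \<Rightarrow> (int, nat list) module" where
  "cup_module p = \<lparr>carrier = mult_less_partitions p, monoid.mult = undefined, one = undefined,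
     zero = [], add = cup p, smult = (\<lambda>a xs. (cup p xs ^^ nat a) [])\<rparr>"

definition plus_module :: "nat \<Rightarrow> (int, nat list) module" where
  "plus_module k = \<lparr>carrier = small_diff_partitions k, monoid.mult = undefined, one = undefined,
     zero = [], add = plus_mod k, smult = (\<lambda>a xs. (plus_mod k xs ^^ nat a) [])\<rparr>"

definition vector_space_over :: "('a, 'c) ring_scheme \<Rightarrow> ('a, 'b, 'd) module_scheme \<Rightarrow> bool" where
  "vector_space_over K V \<longleftrightarrow> field K \<and> Module.module K V"

lemma remove_equal_parts_mod:
  assumes "(remove_equal_parts p)\<^sup>*\<^sup>* M N"
  shows "count N x mod p = count M x mod p \<and> set_mset N \<subseteq> set_mset M"
  using assms
proof induction
  case (step N L)
  then obtain y where y: "p \<le> count N y" "L = N - replicate_mset p y"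
    by (auto simp: remove_equal_parts_def)
  then have "set_mset L \<subseteq> set_mset N" by (auto dest: in_diffD)
  moreover have "count L x mod p = count N x mod p"
    using y by (auto simp: le_mod_geq)
  ultimately show ?case using step.IH by auto
qed simp

lemma remove_equal_parts_ex:
  assumes "0 < p"
  shows "\<exists>N. (remove_equal_parts p)\<^sup>*\<^sup>* M N \<and> (\<forall>x. count N x < p)"
proof (induction "size M" arbitrary: M rule: less_induct)
  case less
  show ?case
  proof (cases "\<forall>x. count M x < p")
    case False
    then obtain x where x: "p \<le> count M x" by (auto simp: not_less)
    let ?N = "M - replicate_mset p x"
    have sub: "replicate_mset p x \<subseteq># M" using x by (simp add: count_le_replicate_mset_subset_eq)
    have "size ?N < size M"
      using sub assms size_mset_mono[OF sub] by (simp add: size_Diff_submset)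
    then obtain N where "(remove_equal_parts p)\<^sup>*\<^sup>* ?N N" "\<forall>x. count N x < p"
      using less by blast
    moreover have "remove_equal_parts p M ?N" using x by (auto simp: remove_equal_parts_def)
    ultimately show ?thesis by (meson converse_rtranclp_into_rtranclp)
  qed auto
qed

lemma partition_eqI:
  assumes "is_partition xs" "is_partition ys" "mset xs = mset ys"
  shows "xs = ys"
proof -
  have "sorted (rev xs)" "sorted (rev ys)" "mset (rev xs) = mset (rev ys)"
    using assms by (auto simp: is_partition_def sorted_wrt_rev)
  then have "rev xs = rev ys" by (metis properties_for_sort)
  then show ?thesis by simp
qed

lemma count_less:
  assumes "0 < p" and "zs \<in> mult_less_partitions p"
  shows "count (mset zs) x < p"
proof (cases "x \<in> set zs")
  case False
  then have "count (mset zs) x = 0" by (simp add: count_eq_zero_iff)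
  then show ?thesis using assms(1) by metis
qed (use assms(2) in \<open>auto simp: mult_less_partitions_def\<close>)

lemma cup_props:
  assumes p: "0 < p" and xs: "is_partition xs" and ys: "is_partition ys"
  shows "cup p xs ys \<in> mult_less_partitions p \<and>
     (remove_equal_parts p)\<^sup>*\<^sup>* (mset xs + mset ys) (mset (cup p xs ys))"
  unfolding cup_def
proof (rule theI')
  have mult: "count (mset zs) x < p" if "zs \<in> mult_less_partitions p" for zs x
    using count_less[OF p that] .
  obtain N where N: "(remove_equal_parts p)\<^sup>*\<^sup>* (mset xs + mset ys) N" "\<forall>x. count N x < p"
    using remove_equal_parts_ex[OF p] by blast
  let ?z = "rev (sorted_list_of_multiset N)"
  have "set_mset N \<subseteq> set xs \<union> set ys" using remove_equal_parts_mod[OF N(1)] by auto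
  then have "?z \<in> mult_less_partitions p"
    using N(2) xs ys by (auto simp: mult_less_partitions_def is_partition_def sorted_wrt_rev)
  then show "\<exists>!zs. zs \<in> mult_less_partitions p \<and>
      (remove_equal_parts p)\<^sup>*\<^sup>* (mset xs + mset ys) (mset zs)"
  proof (intro ex1I[of _ ?z] conjI)
    fix zs
    assume z: "zs \<in> mult_less_partitions p \<and>
      (remove_equal_parts p)\<^sup>*\<^sup>* (mset xs + mset ys) (mset zs)"
    have "count (mset zs) x = count N x" for x
      using z mult[of zs x] N(2) remove_equal_parts_mod[OF N(1), of x]
        remove_equal_parts_mod[of p _ "mset zs" x] by (metis mod_less)
    then have "mset zs = mset ?z" by (simp add: multiset_eq_iff)
    with z \<open>?z \<in> _\<close> show "zs = ?z"
      by (auto simp: mult_less_partitions_def intro: partition_eqI)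
  qed (use N in auto)
qed

lemma count_cup:
  assumes "0 < p" "is_partition xs" "is_partition ys"
  shows "count (mset (cup p xs ys)) x = (count (mset xs) x + count (mset ys) x) mod p"
proof -
  have "count (mset (cup p xs ys)) x < p"
    using cup_props[OF assms] count_less[OF assms(1)] by blast
  then show ?thesis
    using cup_props[OF assms] remove_equal_parts_mod by (metis count_union mod_less)
qed

lemma plus_mod_one_iterate:
  assumes "2 \<le> k"
  shows "(plus_mod k [1] ^^ n) [] = (if n mod k = 0 then [] else [n mod k])"
proof (induction n)
  case (Suc n)
  have *: "x - x div k * k = x mod k" for x :: nat by (simp add: minus_div_mult_eq_mod)
  show ?case
    using Suc assms
    by (auto simp: plus_mod_def reduce_def nth_default_def * mod_Suc strip_while_def)
qed simp

(* Scalar multiplication by residues modulo p, given by iterated addition of representatives,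
   respects addition of scalars only if k = 1 or k = p. *)
lemma plus_module_vector_space_imp:
  fixes p k :: nat
  assumes p: "prime p" and k: "0 < k"
    and V: "vector_space_over (residue_ring (int p)) (plus_module k)"
  shows "k = 1 \<or> k = p"
proof (cases "k = 1")
  case False
  with k have k2: "2 \<le> k" by simp
  interpret module "residue_ring (int p)" "plus_module k"
    using V by (simp add: vector_space_over_def)
  have p2: "2 \<le> p" using p by (rule prime_ge_2_nat)
  have one: "[1] \<in> carrier (plus_module k)"
    using k2 by (simp add: plus_module_def small_diff_partitions_def is_partition_def)
  have "(plus_mod k [1] ^^ nat ((1 + (int p - 1)) mod int p)) [] =
     plus_mod k ((plus_mod k [1] ^^ nat 1) []) ((plus_mod k [1] ^^ nat (int p - 1)) [])"
    using smult_l_distr[OF _ _ one, of 1 "int p - 1"] p2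
    by (simp add: residue_ring_def plus_module_def)
  moreover have "(plus_mod k [1] ^^ nat 1) [] = [1]"
    using plus_mod_one_iterate[OF k2, of 1] k2 by simp
  moreover have "nat (int p - 1) = p - 1" by simp
  ultimately have "[] = (plus_mod k [1] ^^ Suc (p - 1)) []" by simp
  then have "p mod k = 0"
    using plus_mod_one_iterate[OF k2, of "Suc (p - 1)"] p2 by (auto split: if_splits)
  then show ?thesis using p False by (auto simp: prime_nat_iff mod_eq_0_iff_dvd)
qed simp

end

theory Submission
  imports Defs
begin

text \<open>
  Both structures embed into a product of copies of \<open>\<int>/k\<close> with \<open>k\<close> dividing \<open>p\<close>: a partition in the
  first one is determined by the multiplicities of its parts, modulo \<open>p\<close>, and one in the second by
  the residues of its parts modulo \<open>k\<close>, because each part lies in the window of length \<open>k\<close>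
  that starts at the next part. The additions are componentwise in these coordinates, so the module
  laws follow from those of \<open>\<int>/k\<close>. Closure under addition is enough, as \<open>(p - 1) x\<close> is the
  negative of \<open>x\<close>.
\<close>

lemma iterate_coordinates:
  fixes f :: "'b \<Rightarrow> 'i \<Rightarrow> nat"
  assumes "x \<in> C" "z \<in> C" "\<And>x y. x \<in> C \<Longrightarrow> y \<in> C \<Longrightarrow> pl x y \<in> C"
    and "\<And>i. f z i = 0"
    and "\<And>x y i. x \<in> C \<Longrightarrow> y \<in> C \<Longrightarrow> f (pl x y) i = (f x i + f y i) mod k"
  shows "(pl x ^^ n) z \<in> C \<and> (\<forall>i. f ((pl x ^^ n) z) i = n * f x i mod k)"
  using assms by (induction n) (auto simp: mod_simps)

text \<open>Injectivity of \<open>f\<close> on \<open>C\<close> reduces every equation between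
  elements of \<open>C\<close> to congruences modulo \<open>k\<close>. The record has the common
  shape of \<open>cup_module\<close> and \<open>plus_module\<close>, so one argument serves
  both.\<close>

lemma residue_ring_module_of_coordinates:
  fixes f :: "'b \<Rightarrow> 'i \<Rightarrow> nat" and p k :: nat
  assumes p: "prime p" and k: "k dvd p"
    and z: "z \<in> C" and closed: "\<And>x y. x \<in> C \<Longrightarrow> y \<in> C \<Longrightarrow> pl x y \<in> C"
    and fz: "\<And>i. f z i = 0" and less: "\<And>x i. x \<in> C \<Longrightarrow> f x i < k"
    and fadd: "\<And>x y i. x \<in> C \<Longrightarrow> y \<in> C \<Longrightarrow> f (pl x y) i = (f x i + f y i) mod k"
    and inj: "inj_on f C"
  shows "Module.module (residue_ring (int p))
    \<lparr>carrier = C, monoid.mult = undefined, one = undefined, zero = z, add = pl,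
     smult = (\<lambda>a x. (pl x ^^ nat a) z)\<rparr>" (is "Module.module ?R ?M")
proof -
  interpret residues_prime p ?R
    using p by unfold_locales auto
  have eqI: "x = y" if "x \<in> C" "y \<in> C" "\<And>i. f x i = f y i" for x y
    using inj_onD[OF inj _ that(1,2)] that(3) by (simp add: fun_eq_iff)
  have it: "(pl x ^^ n) z \<in> C" "f ((pl x ^^ n) z) i = n * f x i mod k" if "x \<in> C" for x n i
    using iterate_coordinates[where f = f, OF that z closed fz fadd, of n] by auto
  have fmod: "f x i mod k = f x i" if "x \<in> C" for x i
    using less[OF that] by simp
  \<comment> \<open>Sums and products of scalars are reduced modulo \<open>p\<close>, coordinates
    modulo \<open>k\<close>. As \<open>k dvd p\<close>, the first reduction is invisible after the
    second.\<close>
  have red: "n * nat (a mod int p) mod k = n * nat a mod k" if "0 \<le> a" for a n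
  proof -
    have "nat (a mod int p) = nat a mod p"
      using that by (simp add: nat_mod_distrib)
    then show ?thesis
      using k by (metis mod_mod_cancel mod_mult_right_eq)
  qed
  note coords = closed it z fadd fz fmod red
  show ?thesis
  proof (intro module.intro module_axioms.intro cring abelian_groupI)
    fix x assume x: "x \<in> carrier ?M"
    have "pl ((pl x ^^ (p - 1)) z) x = z"
    proof (rule eqI)
      fix i
      have "p - 1 + 1 = p"
        using p prime_gt_0_nat by simp
      then have "(p - 1) * f x i + f x i = p * f x i"
        by (metis add_mult_distrib mult_1)
      then show "f (pl ((pl x ^^ (p - 1)) z) x) i = f z i"
        using x k by (simp add: coords mod_simps)
    qed (use x in \<open>simp_all add: coords\<close>)
    then show "\<exists>y\<in>carrier ?M. y \<oplus>\<^bsub>?M\<^esub> x = \<zero>\<^bsub>?M\<^esub>"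
      using x by (auto intro!: bexI[of _ "(pl x ^^ (p - 1)) z"] simp: coords)
  qed (auto intro!: eqI simp: coords res_carrier_eq res_add_eq res_mult_eq res_one_eq
        nat_add_distrib nat_mult_distrib mod_simps algebra_simps)
qed

lemma cup_module_vector_space:
  assumes p: "prime p"
  shows "vector_space_over (residue_ring (int p)) (cup_module p)"
proof -
  let ?C = "mult_less_partitions p"
  interpret residues_prime p "residue_ring (int p)"
    using p by unfold_locales auto
  have p0: "0 < p"
    using p by (rule prime_gt_0_nat)
  have part: "is_partition xs" if "xs \<in> ?C" for xs
    using that by (simp add: mult_less_partitions_def)
  have "Module.module (residue_ring (int p)) (cup_module p)"
    unfolding cup_module_def
  proof (rule residue_ring_module_of_coordinates[where f = "\<lambda>xs. count (mset xs)" and k = p])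
    \<comment> \<open>Multiplicities fix the multiset of parts, and a weakly decreasing list is
      fixed by its multiset.\<close>
    show "inj_on (\<lambda>xs. count (mset xs)) ?C"
      by (auto intro!: inj_onI partition_eqI part simp: multiset_eq_iff)
    show "[] \<in> ?C"
      by (simp add: mult_less_partitions_def is_partition_def)
  qed (use p p0 in \<open>auto simp: cup_props count_cup count_less part\<close>)
  then show ?thesis
    by (simp add: vector_space_over_def is_field)
qed

text \<open>Reading absent parts as 0 merges the bound on the last part with the bound on the
  differences: at the last index the next part is 0. A nonzero last entry together with monotonicity
  makes all parts positive.\<close>

lemma small_diff_partitions_iff:
  assumes "0 < k"
  shows "xs \<in> small_diff_partitions k \<longleftrightarrow> (xs \<noteq> [] \<longrightarrow> last xs \<noteq> 0) \<and>
    (\<forall>i. part xs (Suc i) \<le> part xs i \<and> part xs i < part xs (Suc i) + k)"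
    (is "_ \<longleftrightarrow> ?last \<and> ?window")
proof
  assume xs: "xs \<in> small_diff_partitions k"
  then have *: "sorted_wrt (\<ge>) xs" "\<forall>x\<in>set xs. 0 < x" "xs \<noteq> [] \<longrightarrow> last xs < k"
    "\<And>i. Suc i < length xs \<Longrightarrow> xs ! i - xs ! Suc i < k"
    by (auto simp: small_diff_partitions_def is_partition_def)
  have "part xs (Suc i) \<le> part xs i \<and> part xs i < part xs (Suc i) + k" for i
  proof -
    consider "Suc i < length xs" | "length xs = Suc i" | "length xs \<le> i"
      by linarith
    then show ?thesis
    proof cases
      case 1
      then have "xs ! Suc i \<le> xs ! i"
        using *(1) by (simp add: sorted_wrt_iff_nth_less)
      then show ?thesis
        using *(4)[OF 1] 1 by (simp add: nth_default_def)
    next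
      case 2
      then show ?thesis
        using *(3) by (cases "xs = []") (auto simp: nth_default_def last_conv_nth)
    qed (use assms in \<open>simp add: nth_default_def\<close>)
  qed
  then show "?last \<and> ?window"
    using *(2) last_in_set by fastforce
next
  assume R: "?last \<and> ?window"
  then have anti: "part xs j \<le> part xs i" if "i \<le> j" for i j
    using that by (auto intro: lift_Suc_antimono_le[of "part xs"])
  have mono: "xs ! j \<le> xs ! i" if "i \<le> j" "j < length xs" for i j
    using anti[OF that(1)] that by (simp add: nth_default_def)
  have "0 < xs ! i" if "i < length xs" for i
  proof -
    have "xs ! (length xs - 1) \<noteq> 0"
      using R that by (cases "xs = []") (auto simp: last_conv_nth)
    moreover have "xs ! (length xs - 1) \<le> xs ! i"
      using that by (intro mono) auto
    ultimately show ?thesis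
      by simp
  qed
  moreover have "xs ! i - xs ! Suc i < k" if "Suc i < length xs" for i
    using R[THEN conjunct2, rule_format, of i] that
    by (simp add: nth_default_def less_diff_conv2)
  moreover have "last xs < k" if "xs \<noteq> []"
    using R[THEN conjunct2, rule_format, of "length xs - 1"] that
    by (simp add: nth_default_def last_conv_nth)
  ultimately show "xs \<in> small_diff_partitions k"
    using mono
    by (auto simp: small_diff_partitions_def is_partition_def sorted_wrt_iff_nth_less
        in_set_conv_nth)
qed

text \<open>Induction from the right end: each entry is lowered by a multiple of \<open>k\<close>
  into the window of length \<open>k\<close> that starts at the reduced next entry.\<close>

lemma part_reduce_raw:
  assumes "0 < k" and "\<forall>i. part xs (Suc i) \<le> part xs i"
  shows "part (reduce_raw k xs) i mod k = part xs i mod k \<and>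
    part (reduce_raw k xs) i \<le> part xs i \<and>
    part (reduce_raw k xs) (Suc i) \<le> part (reduce_raw k xs) i \<and>
    part (reduce_raw k xs) i < part (reduce_raw k xs) (Suc i) + k"
  using assms(2)
proof (induction xs arbitrary: i)
  case Nil
  then show ?case
    using assms(1) by simp
next
  case (Cons x xs)
  have "\<forall>i. part xs (Suc i) \<le> part xs i"
    using Cons.prems[rule_format, of "Suc _"] by simp
  note IH = Cons.IH[OF this]
  define y where "y = part (reduce_raw k xs) 0"
  define q where "q = (x - y) div k"
  \<comment> \<open>The reduced next entry is at most the original next entry, which is at most
    \<open>x\<close>; hence \<open>x - y\<close> does not truncate.\<close>
  have "y \<le> x"
    using IH[of 0] Cons.prems[rule_format, of 0] by (simp add: y_def)
  then have x: "x = y + (x - y) mod k + q * k"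
    unfolding q_def using div_mult_mod_eq[of "x - y" k] by linarith
  then have h: "x - q * k = y + (x - y) mod k"
    by linarith
  have "(x - q * k) mod k = x mod k"
    using h x by (metis mod_mult_self1)
  moreover have "y \<le> x - q * k" "x - q * k < y + k"
    using h assms(1) by simp_all
  moreover have "reduce_raw k (x # xs) = (x - q * k) # reduce_raw k xs"
    by (simp add: Let_def q_def y_def)
  ultimately show ?case
    using IH by (cases i) (simp_all add: y_def)
qed

lemma part_reduce: "part (reduce k xs) i = part (reduce_raw k xs) i"
proof -
  have "(\<lambda>x. x = 0) = (=) (0 :: nat)"
    by auto
  then show ?thesis
    by (simp add: reduce_def nth_default_strip_while_dflt)
qed

text \<open>A componentwise sum of weakly decreasing sequences is again weakly decreasing, which is
  all that the reduction requires; differences of \<open>k\<close> or more may arise in the sum, and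
  the reduction removes them.\<close>

lemma
  assumes "0 < k" and "xs \<in> small_diff_partitions k" and "ys \<in> small_diff_partitions k"
  shows plus_mod_closed: "plus_mod k xs ys \<in> small_diff_partitions k"
    and part_plus_mod: "part (plus_mod k xs ys) i mod k = (part xs i + part ys i) mod k"
proof -
  let ?s = "map (\<lambda>i. part xs i + part ys i) [0..<max (length xs) (length ys)]"
  have s: "part ?s i = part xs i + part ys i" for i
    by (auto simp: nth_default_def)
  then have anti: "\<forall>i. part ?s (Suc i) \<le> part ?s i"
    using assms by (auto simp: small_diff_partitions_iff intro: add_mono)
  note raw = part_reduce_raw[OF assms(1) anti]
  show "part (plus_mod k xs ys) i mod k = (part xs i + part ys i) mod k"
    using raw[of i] s[of i] by (simp add: plus_mod_def part_reduce)
  \<comment> \<open>\<open>strip_while\<close> is \<open>dropWhile\<close> on the reversed list, so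
    this entry is the first one that fails the test for zero.\<close>
  have "last (reduce k ?s) \<noteq> 0" if "reduce k ?s \<noteq> []"
    using that hd_dropWhile[of "\<lambda>x. x = 0" "rev (reduce_raw k ?s)"]
    by (simp add: reduce_def strip_while_def last_rev)
  then show "plus_mod k xs ys \<in> small_diff_partitions k"
    using raw assms(1) by (auto simp: plus_mod_def small_diff_partitions_iff part_reduce)
qed

text \<open>A window of length \<open>k\<close> contains each residue once, so the next part and the
  residue determine a part. Descending from an index beyond both lists, where all parts are 0,
  recovers every part.\<close>

lemma inj_on_part_mod:
  assumes "0 < k"
  shows "inj_on (\<lambda>xs i. part xs i mod k) (small_diff_partitions k)"
proof (rule inj_onI)
  fix xs ys
  assume "xs \<in> small_diff_partitions k" "ys \<in> small_diff_partitions k"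
  then have xs: "xs \<noteq> [] \<Longrightarrow> last xs \<noteq> 0"
    "\<And>i. part xs (Suc i) \<le> part xs i \<and> part xs i < part xs (Suc i) + k"
    and ys: "ys \<noteq> [] \<Longrightarrow> last ys \<noteq> 0"
    "\<And>i. part ys (Suc i) \<le> part ys i \<and> part ys i < part ys (Suc i) + k"
    using assms by (auto simp: small_diff_partitions_iff)
  assume "(\<lambda>i. part xs i mod k) = (\<lambda>i. part ys i mod k)"
  then have cong: "part xs i mod k = part ys i mod k" for i
    by metis
  have step: "part xs i = part ys i" if eq: "part xs (Suc i) = part ys (Suc i)" for i
  proof -
    let ?c = "part ys (Suc i)"
    \<comment> \<open>Subtracting the common next part moves both entries below \<open>k\<close>,
      where congruent numbers are equal.\<close>
    have "(part xs i - ?c) mod k = (part ys i - ?c) mod k"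
      using cong[of i] xs(2)[of i] ys(2)[of i] eq
      by (metis nat_mod_eq_iff diff_add_inverse2 le_add_diff_inverse2 cong_add_rcancel_nat cong_def)
    then have "part xs i - ?c = part ys i - ?c"
      using xs(2)[of i] ys(2)[of i] eq by (simp add: less_diff_conv2)
    then show ?thesis
      using xs(2)[of i] ys(2)[of i] eq by linarith
  qed
  have "part xs i = part ys i" for i
  proof (cases "i \<le> max (length xs) (length ys)")
    case True
    then show ?thesis
      by (induction rule: inc_induct) (auto simp: step nth_default_beyond)
  qed (simp add: nth_default_beyond)
  then have "nth_default 0 xs = nth_default 0 ys"
    by auto
  \<comment> \<open>Equal padded sequences give lists equal up to trailing zeros, and a nonzero last
    entry excludes these.\<close>
  moreover have "strip_while ((=) 0) zs = zs" if "zs \<noteq> [] \<Longrightarrow> last zs \<noteq> 0" for zs :: "nat list"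
    using that by (cases zs rule: rev_cases) auto
  ultimately show "xs = ys"
    using xs(1) ys(1) by (metis nth_default_eq_iff)
qed

text \<open>For prime \<open>p\<close>, the condition \<open>k dvd p\<close> treats
  \<open>k = 1\<close> and \<open>k = p\<close> at once.\<close>

lemma plus_module_vector_space:
  assumes p: "prime p" and k: "k dvd p"
  shows "vector_space_over (residue_ring (int p)) (plus_module k)"
proof -
  interpret residues_prime p "residue_ring (int p)"
    using p by unfold_locales auto
  have k0: "0 < k"
    using p k by (metis dvd_0_left_iff gr0I not_prime_0)
  have "Module.module (residue_ring (int p)) (plus_module k)"
    unfolding plus_module_def
  proof (rule residue_ring_module_of_coordinates[where f = "\<lambda>xs i. part xs i mod k" and k = k])
    show "[] \<in> small_diff_partitions k"
      by (simp add: small_diff_partitions_def is_partition_def)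
  qed (use p k k0 in \<open>auto simp: plus_mod_closed part_plus_mod inj_on_part_mod mod_simps\<close>)
  then show ?thesis
    by (simp add: vector_space_over_def is_field)
qed

text \<open>The restriction on \<open>k\<close> is forced by
  \<open>plus_module_vector_space_imp\<close>: for \<open>2 \<le> k\<close> the multiples of
  \<open>[1]\<close> have period \<open>k\<close>, while distributivity over
  \<open>1 + (p - 1)\<close> requires the \<open>p\<close>-fold sum of \<open>[1]\<close> to be
  empty.\<close>

theorem theorem6:
  fixes p k :: nat
  assumes "prime p" and "0 < k"
  shows "vector_space_over (residue_ring (int p)) (cup_module p) \<and>
    (k = 1 \<or> k = p \<longrightarrow> vector_space_over (residue_ring (int p)) (plus_module k))"
  using assms(1) by (auto intro: cup_module_vector_space plus_module_vector_space)

end
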